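(* Let $ABC$ be a triangle whose circumcenter $O$ lies inside $\triangle ABC$, and let the cevians through $O$ be $AD$, $BE$, $CF$, with $D$ on side $BC$, $E$ on side $CA$, $F$ on side $AB$. Let $r_1$ be the radius of the excircle of $\triangle BOD$ that touches side $BD$, $r_2$ the radius of the excircle of $\triangle COD$ that touches side $DC$, $r_3$ the radius of the excircle of $\triangle COE$ that touches side $CE$, $r_4$ the radius of the excircle of $\triangle AOE$ that touches side $EA$, $r_5$ the radius of the excircle of $\triangle AOF$ that touches side $AF$, and $r_6$ the radius of the excircle of $\triangle BOF$ that touches side $FB$. Then $$\frac{1}{r_1}+\frac{1}{r_3}+\frac{1}{r_5}=\frac{1}{r_2}+\frac{1}{r_4}+\frac{1}{r_6}.$$
   Context: A cevian through a point $P$ inside a triangle is the segment from a vertex through $P$ to the opposite side. The excircle of a triangle that touches a given side is the circle tangent to that side (segment) and to the extensions of the other two sides, lying on the opposite side of that segment from the remaining vertex. *)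

theory Defs
  imports "HOL-Analysis.Analysis"
begin

text \<open>Equidistance pins down the circumcenter only because the ambient space is the plane.\<close>

definition is_circumcenter :: "real^2 \<Rightarrow> real^2 \<Rightarrow> real^2 \<Rightarrow> real^2 \<Rightarrow> bool" where
  "is_circumcenter Q A B C \<longleftrightarrow> (\<exists>R>0. {A, B, C} \<subseteq> sphere Q R)"

text \<open>The segment \<open>V D\<close> is the cevian from the vertex \<open>V\<close> through \<open>P\<close>, with foot \<open>D\<close>
  on the side \<open>X Y\<close>.\<close>

definition is_cevian :: "real^2 \<Rightarrow> real^2 \<Rightarrow> real^2 \<Rightarrow> real^2 \<Rightarrow> real^2 \<Rightarrow> bool" where
  "is_cevian V D P X Y \<longleftrightarrow> D \<in> closed_segment X Y \<and> P \<in> closed_segment V D"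

definition tangent_line_at ::
  "real^2 \<Rightarrow> real \<Rightarrow> real^2 \<Rightarrow> real^2 \<Rightarrow> real^2 \<Rightarrow> bool" where
  "tangent_line_at J r X Y T \<longleftrightarrow> sphere J r \<inter> affine hull {X, Y} = {T}"

text \<open>The circle with center \<open>J\<close> and radius \<open>r\<close> is the excircle of the triangle \<open>V X Y\<close> that
  touches the side \<open>X Y\<close>. It touches the line \<open>V X\<close> beyond \<open>X\<close> and the line \<open>V Y\<close> beyond \<open>Y\<close>;
  the last conjunct says that the line \<open>X Y\<close> separates \<open>V\<close> from every point of the circle, the
  point of tangency being allowed to lie on that line.\<close>

definition is_excircle ::
  "real^2 \<Rightarrow> real^2 \<Rightarrow> real^2 \<Rightarrow> real^2 \<Rightarrow> real \<Rightarrow> bool" where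
  "is_excircle V X Y J r \<longleftrightarrow>
     \<not> collinear {V, X, Y} \<and> r > 0 \<and>
     (\<exists>T. tangent_line_at J r X Y T \<and> T \<in> closed_segment X Y) \<and>
     (\<exists>T. tangent_line_at J r V X T \<and> X \<in> closed_segment V T) \<and>
     (\<exists>T. tangent_line_at J r V Y T \<and> Y \<in> closed_segment V T) \<and>
     (\<forall>Z\<in>sphere J r. closed_segment V Z \<inter> affine hull {X, Y} \<noteq> {})"

text \<open>\<open>r\<close> is the radius of the excircle of the triangle \<open>V X Y\<close> that touches the side \<open>X Y\<close>.\<close>

definition is_exradius :: "real^2 \<Rightarrow> real^2 \<Rightarrow> real^2 \<Rightarrow> real \<Rightarrow> bool" where
  "is_exradius V X Y r \<longleftrightarrow> (\<exists>J. is_excircle V X Y J r)"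

end

theory Submission imports Defs begin

text \<open>The excircle of \<open>V X Y\<close> touching \<open>X Y\<close> has radius
  \<open>2 area / (V X + V Y - X Y)\<close>. Let \<open>x, y, z\<close> be the barycentric coordinates of \<open>Q\<close>, let
  \<open>R\<close> be the circumradius and \<open>S\<close> twice the area of \<open>A B C\<close>. Since \<open>Q D = x R / (y + z)\<close>,
  \<open>B D = z B C / (y + z)\<close> and \<open>Q B D\<close> has twice the area \<open>x z S / (y + z)\<close>, this gives
  \<open>1 / r1 = R / (x z S) - B C / (x S)\<close>. In each of the two sums the first terms
  run over all three pairs of coordinates and the second terms over all three sides.\<close>

section \<open>The planar cross product and collinearity\<close>

definition cross2 :: "real^2 \<Rightarrow> real^2 \<Rightarrow> real" where
  "cross2 u v = u$1 * v$2 - u$2 * v$1"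

lemma inner_real2: "(u::real^2) \<bullet> v = u$1 * v$1 + u$2 * v$2"
  by (simp add: inner_vec_def sum_2)

text \<open>Lagrange's identity. For perpendicular vectors it turns
  \<open>\<bar>cross2 u v\<bar>\<close> into the product of the norms.\<close>

lemma cross2_square_add_inner_square:
  "(cross2 u v)\<^sup>2 + (u \<bullet> v)\<^sup>2 = (norm u)\<^sup>2 * (norm v)\<^sup>2"
  unfolding cross2_def power2_norm_eq_inner inner_real2 by algebra

lemma collinear_if_cross2_zero:
  assumes "cross2 (B - A) (C - A) = 0"
  shows "collinear {A, B, C}"
proof -
  define u v where "u = B - A" and "v = C - A"
  have uv: "u$1 * v$2 = u$2 * v$1"
    using assms by (simp add: u_def v_def cross2_def)
  have "collinear {0, u, v}"
  proof (cases "u = 0")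
    case True
    then show ?thesis by (simp add: collinear_lemma)
  next
    case False
    have nz: "u$1 * u$1 + u$2 * u$2 \<noteq> 0"
      using False by (metis inner_eq_zero_iff inner_real2)
    \<comment> \<open>The coefficient of the orthogonal projection of \<open>v\<close> onto
      \<open>u\<close>; a vanishing cross product makes \<open>v\<close> equal to that
      projection.\<close>
    define c where "c = (u \<bullet> v) / (u \<bullet> u)"
    have "v$1 * (u \<bullet> u) = (u \<bullet> v) * u$1" "v$2 * (u \<bullet> u) = (u \<bullet> v) * u$2"
      using uv unfolding inner_real2 by algebra+
    then have "v$1 = c * u$1" "v$2 = c * u$2"
      using nz unfolding c_def by (simp_all add: inner_real2 field_simps)
    then have "v = c *\<^sub>R u" by (simp add: vec_eq_iff forall_2)
    then show ?thesis by (auto simp: collinear_lemma)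
  qed
  moreover have "{B, A, C} = {A, B, C}" by auto
  ultimately show ?thesis
    using collinear_3[of B A C] by (simp add: u_def v_def)
qed

section \<open>Lines tangent to a circle\<close>

lemma affine_hull_2_param:
  fixes X Y :: "'a::real_vector"
  shows "P \<in> affine hull {X, Y} \<longleftrightarrow> (\<exists>t. P = X + t *\<^sub>R (Y - X))"
  by (auto simp: affine_hull_2_alt)

text \<open>The reflection of \<open>T\<close> in the foot of the perpendicular from \<open>J\<close> lies on both the line and
  the circle, so it is \<open>T\<close> itself.\<close>

lemma tangent_line_at_perp:
  assumes "tangent_line_at J r X Y T"
  shows "dist J T = r" and "(J - T) \<bullet> (Y - X) = 0"
proof -
  have T: "T \<in> sphere J r" "T \<in> affine hull {X, Y}"
    and uniq: "\<And>P. P \<in> sphere J r \<Longrightarrow> P \<in> affine hull {X, Y} \<Longrightarrow> P = T"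
    using assms unfolding tangent_line_at_def by blast+
  show "dist J T = r" using T by simp
  define w where "w = Y - X"
  define k where "k = 2 * ((J - T) \<bullet> w) / (w \<bullet> w)"
  obtain t where t: "T = X + t *\<^sub>R w"
    using T(2) by (auto simp: affine_hull_2_param w_def)
  have "T + k *\<^sub>R w = X + (t + k) *\<^sub>R w" by (simp add: t algebra_simps)
  then have line: "T + k *\<^sub>R w \<in> affine hull {X, Y}"
    unfolding affine_hull_2_param w_def by blast
  have "(J - (T + k *\<^sub>R w)) \<bullet> (J - (T + k *\<^sub>R w))
      = (J - T) \<bullet> (J - T) - k * (2 * ((J - T) \<bullet> w) - k * (w \<bullet> w))"
    by (simp add: inner_diff_left inner_diff_right inner_add_left inner_add_right inner_commute
        algebra_simps)
  also have "\<dots> = (J - T) \<bullet> (J - T)"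
    by (cases "w = 0") (simp_all add: k_def)
  finally have "dist J (T + k *\<^sub>R w) = dist J T"
    by (simp add: dist_norm norm_eq_sqrt_inner)
  then have "k *\<^sub>R w = 0"
    using uniq[OF _ line] T(1) by simp
  then show "(J - T) \<bullet> (Y - X) = 0"
    by (auto simp: k_def w_def)
qed

text \<open>Twice the area of the triangle \<open>X Y J\<close>, with base \<open>X Y\<close> and
  height \<open>r\<close>. Moving the foot \<open>X\<close> to \<open>T\<close> along the line keeps
  the cross product, and \<open>J - T\<close> is perpendicular to the line.\<close>

lemma tangent_line_at_abs_cross2:
  assumes "tangent_line_at J r X Y T"
  shows "\<bar>cross2 (Y - X) (J - X)\<bar> = r * dist X Y"
proof -
  have "T \<in> affine hull {X, Y}" using assms by (auto simp: tangent_line_at_def)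
  then obtain t where t: "T = X + t *\<^sub>R (Y - X)" by (auto simp: affine_hull_2_param)
  have "cross2 (Y - X) (J - X) = cross2 (Y - X) (J - T)"
    by (simp add: cross2_def t algebra_simps)
  moreover have "\<bar>cross2 (Y - X) (J - T)\<bar> = \<bar>r * dist X Y\<bar>"
    unfolding abs_eq_iff power2_eq_iff[symmetric]
    using cross2_square_add_inner_square[of "Y - X" "J - T"] tangent_line_at_perp[OF assms]
    by (simp add: inner_commute dist_norm power_mult_distrib norm_minus_commute)
  moreover have "r \<ge> 0" using tangent_line_at_perp(1)[OF assms] by auto
  ultimately show ?thesis
    by simp
qed

text \<open>\<open>T\<close> is the orthogonal projection of \<open>J\<close> onto the line, and
  \<open>X\<close> lies between \<open>V\<close> and \<open>T\<close>, which fixes the sign of the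
  inner product. Pythagoras in \<open>V T J\<close> later shows that both tangent lengths from
  \<open>V\<close> agree.\<close>

lemma tangent_line_at_beyond_inner:
  assumes "tangent_line_at J r V X T" and "X \<in> closed_segment V T"
  shows "(X - V) \<bullet> (J - V) = dist V T * dist V X" and "(dist V T)\<^sup>2 + r\<^sup>2 = (dist V J)\<^sup>2"
proof -
  obtain s where s: "0 \<le> s" "X - V = s *\<^sub>R (T - V)"
    using assms(2) by (auto simp: in_segment algebra_simps)
  have "T \<in> affine hull {V, X}" using assms(1) by (auto simp: tangent_line_at_def)
  then obtain t where "T = V + t *\<^sub>R (X - V)" by (auto simp: affine_hull_2_param)
  then have t: "T - V = t *\<^sub>R (X - V)" by simp
  note perp = tangent_line_at_perp[OF assms(1)]
  have split: "J - V = (T - V) + (J - T)" by simp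
  have "(X - V) \<bullet> (J - V) = (X - V) \<bullet> (T - V)"
    using perp(2) unfolding split by (subst inner_add_right) (simp add: inner_commute)
  also have "\<dots> = (s * dist V T) * dist V T"
    by (simp add: s(2) dist_norm norm_minus_commute power2_eq_square flip: power2_norm_eq_inner)
  also have "s * dist V T = dist V X"
    unfolding dist_norm norm_minus_commute[of V] s(2) using s(1) by simp
  finally show "(X - V) \<bullet> (J - V) = dist V T * dist V X" by (simp only: mult.commute)
  have "(T - V) \<bullet> (J - T) = 0"
    using perp(2) by (simp add: t inner_commute)
  then show "(dist V T)\<^sup>2 + r\<^sup>2 = (dist V J)\<^sup>2"
    using perp(1) norm_add_Pythagorean[of "T - V" "J - T"]
    by (simp add: dist_norm norm_minus_commute orthogonal_def)
qed

section \<open>The exradius formula\<close>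

text \<open>The triangle \<open>V X Y\<close> is \<open>V X J\<close> plus \<open>V Y J\<close>
  minus \<open>X Y J\<close>, and these three have height \<open>r\<close> over the sides of
  \<open>V X Y\<close>. The work lies in determining the three signs.\<close>

lemma is_exradius_cross2_pos:
  assumes "is_exradius V X Y r" and pos: "cross2 (X - V) (Y - V) > 0"
  shows "r * (dist V X + dist V Y - dist X Y) = cross2 (X - V) (Y - V)"
proof -
  obtain J T T1 T2 where r: "r > 0"
    and T: "tangent_line_at J r X Y T"
    and T1: "tangent_line_at J r V X T1" "X \<in> closed_segment V T1"
    and T2: "tangent_line_at J r V Y T2" "Y \<in> closed_segment V T2"
    and sep: "\<forall>Z\<in>sphere J r. closed_segment V Z \<inter> affine hull {X, Y} \<noteq> {}"
    using assms(1) unfolding is_exradius_def is_excircle_def by auto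
  define u v j where "u = X - V" and "v = Y - V" and "j = J - V"
  define L where "L = dist V T1"
  have X0: "dist V X > 0" and Y0: "dist V Y > 0"
    using pos by (auto simp: cross2_def)
  \<comment> \<open>This affine function of \<open>Z\<close> vanishes on the line \<open>X Y\<close>
    and is positive at \<open>V\<close>; were it positive at \<open>Z\<close> too, the segment
    \<open>V Z\<close> would miss the line.\<close>
  have f_nonpos: "cross2 (Y - X) (Z - X) \<le> 0" if Z: "Z \<in> sphere J r" for Z
  proof -
    obtain P where "P \<in> closed_segment V Z" and PL: "P \<in> affine hull {X, Y}"
      using sep Z by blast
    then obtain s where s: "0 \<le> s" "s \<le> 1" "P = (1 - s) *\<^sub>R V + s *\<^sub>R Z"
      by (auto simp: in_segment)
    obtain t where t: "P = X + t *\<^sub>R (Y - X)" using PL by (auto simp: affine_hull_2_param)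
    have "cross2 (Y - X) (P - X) = 0" by (simp add: t cross2_def)
    moreover have "cross2 (Y - X) (P - X)
        = (1 - s) * cross2 (X - V) (Y - V) + s * cross2 (Y - X) (Z - X)"
      by (simp add: s(3) cross2_def algebra_simps)
    ultimately have *: "(1 - s) * cross2 (X - V) (Y - V) + s * cross2 (Y - X) (Z - X) = 0"
      by simp
    show ?thesis
    proof (rule ccontr)
      assume "\<not> ?thesis"
      then have Zp: "cross2 (Y - X) (Z - X) > 0" by simp
      show False
      proof (cases "s = 0")
        case True with * pos show False by simp
      next
        case False
        then have "s * cross2 (Y - X) (Z - X) > 0" using s Zp by simp
        moreover have "(1 - s) * cross2 (X - V) (Y - V) \<ge> 0" using s pos by simp
        ultimately show False using * by simp
      qed
    qed
  qed
  \<comment> \<open>The center is the midpoint of the antipodal points \<open>J + e\<close> and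
    \<open>J - e\<close>, so the sign passes from the circle to \<open>J\<close>.\<close>
  define e :: "real^2" where "e = r *\<^sub>R axis 1 1"
  have e: "norm e = r" using r by (simp add: e_def)
  have "J + e \<in> sphere J r" "J - e \<in> sphere J r" by (simp_all add: dist_norm e)
  then have "cross2 (Y - X) (J + e - X) + cross2 (Y - X) (J - e - X) \<le> 0"
    using f_nonpos by (meson add_nonpos_nonpos)
  then have "cross2 (Y - X) (J - X) \<le> 0"
    by (simp add: cross2_def algebra_simps)
  then have side: "cross2 (Y - X) (J - X) = - (r * dist X Y)"
    using tangent_line_at_abs_cross2[OF T] by simp
  have id: "cross2 u v = cross2 u j + cross2 j v + cross2 (Y - X) (J - X)"
    by (simp add: u_def v_def j_def cross2_def algebra_simps)
  have abs1: "\<bar>cross2 u j\<bar> = r * dist V X"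
    using tangent_line_at_abs_cross2[OF T1(1)] by (simp add: u_def j_def)
  have "cross2 j v = - cross2 v j" by (simp add: cross2_def)
  then have abs2: "\<bar>cross2 j v\<bar> = r * dist V Y"
    using tangent_line_at_abs_cross2[OF T2(1)] by (simp add: v_def j_def)
  have "(dist V T1)\<^sup>2 = (dist V T2)\<^sup>2"
    using tangent_line_at_beyond_inner(2)[OF T1] tangent_line_at_beyond_inner(2)[OF T2] by linarith
  then have "dist V T2 = L" by (simp add: L_def)
  then have in1: "u \<bullet> j = L * dist V X" and in2: "v \<bullet> j = L * dist V Y"
    using tangent_line_at_beyond_inner(1)[OF T1] tangent_line_at_beyond_inner(1)[OF T2]
    by (simp_all add: L_def u_def v_def j_def)
  text \<open>If \<open>J\<close> were on the same side of the rays \<open>V X\<close> and \<open>V Y\<close>, both rays would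
    make the same oriented angle with \<open>V J\<close> and hence coincide.\<close>
  have not_same: False
    if "cross2 u j = k * dist V X" "cross2 v j = k * dist V Y" "k \<noteq> 0" for k
  proof -
    have jj: "j \<bullet> j \<noteq> 0" using that X0 by (auto simp: cross2_def)
    have "(u \<bullet> j) * cross2 v j = (v \<bullet> j) * cross2 u j"
      using in1 in2 that by simp
    moreover have "(u \<bullet> j) * cross2 v j - (v \<bullet> j) * cross2 u j = - cross2 u v * (j \<bullet> j)"
      unfolding cross2_def inner_real2 by algebra
    ultimately show False using jj pos by (simp add: u_def v_def)
  qed
  \<comment> \<open>Of the four sign patterns for \<open>cross2 u j\<close> and
    \<open>cross2 j v\<close>, \<open>not_same\<close> excludes the two mixed ones; two negative
    signs would make \<open>cross2 u v\<close> negative by \<open>id\<close> and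
    \<open>side\<close>.\<close>
  have rX: "r * dist V X > 0" and rY: "r * dist V Y > 0" and "r * dist X Y \<ge> 0"
    using r X0 Y0 by simp_all
  moreover have "cross2 v j = - cross2 j v" by (simp add: cross2_def)
  moreover have "cross2 u v > 0" using pos by (simp add: u_def v_def)
  ultimately have "cross2 u j = r * dist V X \<and> cross2 j v = r * dist V Y"
    using not_same[of r] not_same[of "- r"] abs1 abs2 id side r
    by (smt (verit) mult_minus_left)
  then show ?thesis
    using id side by (simp add: u_def v_def algebra_simps)
qed

lemma is_exradius_sym:
  assumes "is_exradius V X Y r"
  shows "is_exradius V Y X r"
proof -
  have "{V, Y, X} = {V, X, Y}" "{Y, X} = {X, Y}" by auto
  then show ?thesis
    using assms unfolding is_exradius_def is_excircle_def tangent_line_at_def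
    by (metis closed_segment_commute)
qed

lemma is_exradius_eq:
  assumes "is_exradius V X Y r"
  shows "r * (dist V X + dist V Y - dist X Y) = \<bar>cross2 (X - V) (Y - V)\<bar>"
proof -
  have "cross2 (X - V) (Y - V) \<noteq> 0"
    using assms collinear_if_cross2_zero
    unfolding is_exradius_def is_excircle_def by blast
  moreover have swap: "cross2 (Y - V) (X - V) = - cross2 (X - V) (Y - V)"
    by (simp add: cross2_def)
  ultimately consider "cross2 (X - V) (Y - V) > 0" | "cross2 (Y - V) (X - V) > 0" by linarith
  then show ?thesis
  proof cases
    case 1
    then show ?thesis using is_exradius_cross2_pos[OF assms] by simp
  next
    case 2
    then show ?thesis
      using is_exradius_cross2_pos[OF is_exradius_sym[OF assms]] swap
      by (simp add: dist_commute add.commute)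
  qed
qed

section \<open>Cevians in barycentric coordinates\<close>

text \<open>Cross products based at \<open>A\<close> read off the coordinates of \<open>Q\<close> at
  \<open>B\<close> and \<open>C\<close>; comparing them with the two segment parameters determines
  \<open>s\<close> and \<open>t\<close>.\<close>

lemma is_cevian_barycentric:
  assumes "cross2 (B - A) (C - A) \<noteq> 0"
    and Q: "Q = x *\<^sub>R A + y *\<^sub>R B + z *\<^sub>R C" "x + y + z = 1" and pos: "0 < y + z"
    and "is_cevian A D Q B C"
  shows "D = (y / (y + z)) *\<^sub>R B + (z / (y + z)) *\<^sub>R C"
proof -
  obtain t s where D: "D = (1 - t) *\<^sub>R B + t *\<^sub>R C" and QD: "Q = (1 - s) *\<^sub>R A + s *\<^sub>R D"
    using assms(5) by (auto simp: is_cevian_def in_segment)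
  have x: "x = 1 - y - z" using Q(2) by simp
  have c1: "cross2 (Q - A) (C - A) = y * cross2 (B - A) (C - A)"
    and c2: "cross2 (B - A) (Q - A) = z * cross2 (B - A) (C - A)"
    unfolding Q(1) x by (simp_all add: cross2_def algebra_simps)
  have "cross2 (Q - A) (C - A) = (s * (1 - t)) * cross2 (B - A) (C - A)"
    and "cross2 (B - A) (Q - A) = (s * t) * cross2 (B - A) (C - A)"
    unfolding QD D by (simp_all add: cross2_def algebra_simps)
  then have y: "y = s * (1 - t)" and z: "z = s * t"
    using c1 c2 assms(1) by simp_all
  have "s = y + z" by (simp add: y z algebra_simps)
  then have "t = z / (y + z)" "1 - t = y / (y + z)"
    using pos y z by (simp_all add: field_simps)
  then show ?thesis using D by simp
qed

lemma inverse_exradius_cevian: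
  assumes ncol: "cross2 (B - A) (C - A) \<noteq> 0"
    and Q: "Q = x *\<^sub>R A + y *\<^sub>R B + z *\<^sub>R C" "x + y + z = 1"
    and pos: "0 < x" "0 < y" "0 < z"
    and cev: "is_cevian A D Q B C"
    and R: "dist Q A = R" "dist Q B = R"
    and ex: "is_exradius Q B D r"
  shows "1 / r = R / (x * z * \<bar>cross2 (B - A) (C - A)\<bar>)
    - dist B C / (x * \<bar>cross2 (B - A) (C - A)\<bar>)"
proof -
  define S where "S = \<bar>cross2 (B - A) (C - A)\<bar>"
  have S: "S > 0" using ncol by (simp add: S_def)
  define m where "m = y + z"
  have m: "m > 0" using pos by (simp add: m_def)
  have D: "D = (y / m) *\<^sub>R B + (z / m) *\<^sub>R C"
    using is_cevian_barycentric[OF ncol Q _ cev] pos by (simp add: m_def)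
  have x: "x = 1 - m" using Q(2) by (simp add: m_def)
  have y: "y = m - z" by (simp add: m_def)
  have "m *\<^sub>R D = y *\<^sub>R B + z *\<^sub>R C"
    using m by (simp add: D scaleR_add_right)
  \<comment> \<open>So \<open>Q\<close> divides the cevian with \<open>Q D\<close> to
    \<open>Q A\<close> as \<open>x\<close> to \<open>m\<close>.\<close>
  then have QmD: "Q = x *\<^sub>R A + m *\<^sub>R D" by (simp add: Q(1) add.assoc)
  have "m *\<^sub>R (Q - D) = x *\<^sub>R (A - Q)"
  proof -
    have "m *\<^sub>R (Q - D) = m *\<^sub>R Q - (Q - x *\<^sub>R A)" by (simp add: QmD algebra_simps)
    also have "\<dots> = x *\<^sub>R (A - Q)" by (simp add: x algebra_simps)
    finally show ?thesis .
  qed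
  then have "m * dist Q D = x * dist A Q"
    using m pos unfolding dist_norm by (metis abs_of_pos norm_scaleR)
  then have QD: "dist Q D = x * R / m"
    using m R by (simp add: dist_commute field_simps)
  have "B - D = (z / m) *\<^sub>R (B - C)"
    using m by (simp add: D y diff_divide_distrib algebra_simps)
  then have BD: "dist B D = z * dist B C / m"
    using m pos by (simp add: dist_norm)
  have "cross2 (B - Q) (D - Q) = (x * z / m) * cross2 (B - A) (C - A)"
  proof -
    define k where "k = z / m"
    have y': "y / m = 1 - k" using m by (simp add: y k_def diff_divide_distrib)
    have "cross2 (B - Q) (D - Q) = x * cross2 (B - A) (D - A)"
      unfolding QmD x by (simp add: cross2_def algebra_simps)
    also have "cross2 (B - A) (D - A) = (z / m) * cross2 (B - A) (C - A)"
      unfolding D y' k_def[symmetric] by (simp add: cross2_def algebra_simps)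
    finally show ?thesis by simp
  qed
  then have area: "\<bar>cross2 (B - Q) (D - Q)\<bar> = x * z * S / m"
    using m pos by (simp add: S_def abs_mult)
  have "r * (R + x * R / m - z * dist B C / m) = x * z * S / m"
    using is_exradius_eq[OF ex] unfolding area QD BD R .
  \<comment> \<open>Since \<open>x + m = 1\<close>, the sum \<open>R + x * R / m\<close> is
    \<open>R / m\<close>, and the denominator cancels.\<close>
  then have "r * (R - z * dist B C) = x * z * S"
    using m by (simp add: x field_simps)
  moreover have "r > 0" using ex by (auto simp: is_exradius_def is_excircle_def)
  ultimately show ?thesis
    unfolding S_def[symmetric] using pos S by (simp add: field_simps)
qed

theorem theorem7p2:
  fixes A B C Q D E F :: "real^2" and r1 r2 r3 r4 r5 r6 :: real
  assumes "\<not> collinear {A, B, C}"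
    and "is_circumcenter Q A B C"
    and "Q \<in> interior (convex hull {A, B, C})"
    and "is_cevian A D Q B C"
    and "is_cevian B E Q C A"
    and "is_cevian C F Q A B"
    and "is_exradius Q B D r1"
    and "is_exradius Q D C r2"
    and "is_exradius Q C E r3"
    and "is_exradius Q E A r4"
    and "is_exradius Q A F r5"
    and "is_exradius Q F B r6"
  shows "1 / r1 + 1 / r3 + 1 / r5 = 1 / r2 + 1 / r4 + 1 / r6"
proof -
  obtain R where R: "dist Q A = R" "dist Q B = R" "dist Q C = R"
    using assms(2) by (auto simp: is_circumcenter_def)
  obtain x y z where pos: "0 < x" "0 < y" "0 < z" and sum: "x + y + z = 1"
    and Q: "x *\<^sub>R A + y *\<^sub>R B + z *\<^sub>R C = Q"
    using assms(3) interior_convex_hull_3_minimal[OF assms(1)] by auto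
  define S where "S = \<bar>cross2 (B - A) (C - A)\<bar>"
  have ncol: "cross2 (B - A) (C - A) \<noteq> 0"
    using assms(1) collinear_if_cross2_zero by blast
  \<comment> \<open>Relabelling the vertices changes at most the sign, so all six instances share
    the same \<open>S\<close>.\<close>
  have cr: "cross2 (C - B) (A - B) = cross2 (B - A) (C - A)"
    "cross2 (A - C) (B - C) = cross2 (B - A) (C - A)"
    "cross2 (C - A) (B - A) = - cross2 (B - A) (C - A)"
    "cross2 (A - B) (C - B) = - cross2 (B - A) (C - A)"
    "cross2 (B - C) (A - C) = - cross2 (B - A) (C - A)"
    by (simp_all add: cross2_def algebra_simps)
  have cev_sym: "is_cevian V P Q Y X" if "is_cevian V P Q X Y" for V P X Y
    using that by (simp add: is_cevian_def closed_segment_commute)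
  note formula = inverse_exradius_cevian[of _ _ _ Q _ _ _ _ R]
  note ex_sym = assms(8,10,12)[THEN is_exradius_sym]
  \<comment> \<open>Each instance names the endpoint in the small triangle, the cevian's vertex and
    the other endpoint; the coordinates follow in the order cevian's vertex, near endpoint, far
    endpoint.\<close>
  have "1 / r1 = R / (x * z * S) - dist B C / (x * S)"
    using formula[of B A C x y z D r1] assms R pos sum Q ncol by (simp add: S_def)
  moreover have "1 / r2 = R / (x * y * S) - dist C B / (x * S)"
    using formula[of C A B x z y D r2] assms cev_sym ex_sym R pos sum Q ncol
    by (simp add: S_def cr add_ac)
  moreover have "1 / r3 = R / (y * x * S) - dist C A / (y * S)"
    using formula[of C B A y z x E r3] assms R pos sum Q ncol by (simp add: S_def cr add_ac)
  moreover have "1 / r4 = R / (y * z * S) - dist A C / (y * S)"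
    using formula[of A B C y x z E r4] assms cev_sym ex_sym R pos sum Q ncol
    by (simp add: S_def cr add_ac)
  moreover have "1 / r5 = R / (z * y * S) - dist A B / (z * S)"
    using formula[of A C B z x y F r5] assms R pos sum Q ncol by (simp add: S_def cr add_ac)
  moreover have "1 / r6 = R / (z * x * S) - dist B A / (z * S)"
    using formula[of B C A z y x F r6] assms cev_sym ex_sym R pos sum Q ncol
    by (simp add: S_def cr add_ac)
  ultimately show ?thesis
    by (simp add: dist_commute mult.commute)
qed

end
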